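(* Let $X=\mathbb{R}$, $A=B=\mathbb{R}_+=[0,+\infty)$ (with the usual metrics), let $\Phi_A(x)=\mathbb{R}_+$ for all $x\in X$, and let $\Phi_B(x,a)=[\phi_B(x,a),+\infty)$ for all $(x,a)\in X\times A$, where $$\phi_B(x,a)=\begin{cases}0, & \text{if } x\le 0,\ \text{or } x>0 \text{ and } 0\le a<\frac{1}{2x};\\ 2(2x+1)a-2-\frac1x, & \text{if } x>0 \text{ and } \frac1{2x}\le a\le \frac1x;\\ 2+\frac1x, & \text{if } x>0\text{ and } a>\frac1x.\end{cases}$$ For $x\in X$, $a\in\Phi_A(x)$, $b\in\Phi_B(x,a)$ let $$f(x,a,b)=\begin{cases}1+a-b, & \text{if } x\le 0,\ \text{or } x>0 \text{ and } 0\le a<\frac{1}{2x};\\ (2x+1)a-b, & \text{if } x>0 \text{ and } \frac1{2x}\le a\le \frac1x;\\ 2+a-b, & \text{if } x>0\text{ and } a>\frac1x.\end{cases}$$ Then the following hold. (1) The multifunctions $\Phi_A:X\to 2^A\setminus\{\emptyset\}$ and $\Phi_B:\mathrm{Gr}(\Phi_A)\to 2^B\setminus\{\emptyset\}$ are continuous (both lower and upper semi-continuous); in particular $\Phi_B$ is lower semi-continuous. However, $\Phi_B$ is not $A$-lower semi-continuous. (2) The function $f^{A\leftrightarrow B}:\mathrm{Gr}(\Phi_B^{A\leftrightarrow B})\subset (X\times B)\times A\to\mathbb{R}$ is $\mathbb{K}$-inf-compact on $\mathrm{Gr}(\Phi_B^{A\leftrightarrow B})$, and the function $f:\mathrm{Gr}(\Phi_B)\subset(X\times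 A)\times B\to\mathbb{R}$ is $\mathbb{K}$-sup-compact on $\mathrm{Gr}(\Phi_B)$; in particular, both functions are continuous. (3) The worst-loss function is $$f^\sharp(x,a)=\begin{cases}1+a, & \text{if } x\le 0,\ \text{or } x>0 \text{ and } 0\le a<\frac{1}{2x};\\ (2x+1)\left(\frac1x-a\right), & \text{if } x>0 \text{ and } \frac1{2x}\le a\le \frac1x;\\ a-\frac1x, & \text{if } x>0\text{ and } a>\frac1x;\end{cases}$$ it is continuous on $\mathrm{Gr}(\Phi_A)=X\times A$, but it is not $\mathbb{K}$-inf-compact on $\mathrm{Gr}(\Phi_A)$. (4) The minimax value function is $v^\sharp(x)=1$ for $x\le 0$ and $v^\sharp(x)=0$ for $x>0$, and it is not lower semi-continuous at $x=0$. (5) The solution multifunction is $\Phi_A^*(x)=\{0\}$ for $x\le 0$ and $\Phi_A^*(x)=\{\frac1x\}$ for $x>0$, and it is not upper semi-continuous at $x=0$.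
   Context: Let $X,A,B$ be metric spaces, let $\Phi_A$ assign to each $x\in X$ a nonempty subset $\Phi_A(x)\subset A$, let $\mathrm{Gr}(\Phi_A)=\{(x,a): x\in X, a\in\Phi_A(x)\}$, let $\Phi_B$ assign to each $(x,a)\in\mathrm{Gr}(\Phi_A)$ a nonempty subset $\Phi_B(x,a)\subset B$, let $\mathrm{Gr}(\Phi_B)=\{(x,a,b):(x,a)\in\mathrm{Gr}(\Phi_A), b\in\Phi_B(x,a)\}$, and let $f:\mathrm{Gr}(\Phi_B)\to\overline{\mathbb{R}}=\mathbb{R}\cup\{\pm\infty\}$. Worst-loss function: $f^\sharp(x,a)=\sup_{b\in\Phi_B(x,a)}f(x,a,b)$ for $(x,a)\in\mathrm{Gr}(\Phi_A)$. Minimax value function: $v^\sharp(x)=\inf_{a\in\Phi_A(x)}f^\sharp(x,a)$ for $x\in X$. Solution multifunction: $\Phi_A^*(x)=\{a\in\Phi_A(x): v^\sharp(x)=f^\sharp(x,a)\}$. Swapped objects: $\Phi_B^{A\leftrightarrow B}:X\times B\to 2^A$ is given by $\Phi_B^{A\leftrightarrow B}(x,b)=\{a\in\Phi_A(x): b\in\Phi_B(x,a)\}$ (possibly empty), so $\mathrm{Gr}(\Phi_B^{A\leftrightarrow B})=\{(x,b,a):(x,a,b)\in\mathrm{Gr}(\Phi_B)\}$; and $f^{A\leftrightarrow B}(x,b,a)=f(x,a,b)$ for $(x,a,b)\in\mathrm{Gr}(\Phi_B)$. Semi-continuity of multifunctions: for metric spaces $\mathbb{X},\mathbb{Y}$ and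 $F:\mathbb{X}\to2^{\mathbb{Y}}$ with $\mathrm{Dom}\,F=\{x:F(x)\neq\emptyset\}$, $F$ is upper semi-continuous at $x\in\mathrm{Dom}\,F$ if for each neighborhood $\mathcal{G}$ of the set $F(x)$ there is a neighborhood $U(x)$ of $x$ with $F(x^* )\subset\mathcal{G}$ for all $x^*\in U(x)\cap\mathrm{Dom}\,F$; $F$ is lower semi-continuous at $x\in\mathrm{Dom}\,F$ if for each open $\mathcal{G}$ with $F(x)\cap\mathcal{G}\neq\emptyset$ there is a neighborhood $U(x)$ of $x$ with $F(x^* )\cap\mathcal{G}\ne\emptyset$ for all $x^*\in U(x)\cap\mathrm{Dom}\,F$. $F$ is upper/lower semi-continuous if it is so at every point of $\mathrm{Dom}\,F$, and continuous if it is both. $A$-lower semi-continuity: $\Phi_B:\mathrm{Gr}(\Phi_A)\to 2^B\setminus\{\emptyset\}$ is $A$-lower semi-continuous if, whenever $x_n\to x$ in $X$, $a_n\in\Phi_A(x_n)$ for each $n=1,2,\dots$ (no convergence of $a_n$ is assumed), and $b\in\Phi_B(x,a)$ for some $a\in\Phi_A(x)$, there is a sequence $b_n\in\Phi_B(x_n,a_n)$, $n=1,2,\dots$, such that $b$ is a limit point of $\{b_n\}$ (i.e. the limit of some subsequence). Compactness notions for functions: a function $g:S\to\overline{\mathbb{R}}$ on a subset $S$ of a metric space is inf-compact on $S$ if all level sets $\{s\in S: g(s)\le\lambda\}$, $\lambda\in\mathbb{R}$, are compact. For $\Phi:\mathbb{X}\to2^{\mathbb{Y}}$, a function $u:\mathrm{Gr}(\Phi)\subset\mathbb{X}\times\mathbb{Y}\to\overline{\mathbb{R}}$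 is $\mathbb{K}$-inf-compact on $\mathrm{Gr}(\Phi)$ if for every nonempty compact $C\subset\mathrm{Dom}\,\Phi$ it is inf-compact on $\{(x,y): x\in C, y\in\Phi(x)\}$; $u$ is $\mathbb{K}$-sup-compact on $\mathrm{Gr}(\Phi)$ if $-u$ is $\mathbb{K}$-inf-compact on $\mathrm{Gr}(\Phi)$. Here $\mathbb{K}$-sup-compactness of $f$ is with respect to $\Phi_B$ (with $\mathbb{X}=X\times A$, $\mathbb{Y}=B$, $\mathrm{Dom}\,\Phi_B=\mathrm{Gr}(\Phi_A)$), $\mathbb{K}$-inf-compactness of $f^{A\leftrightarrow B}$ is with respect to $\Phi_B^{A\leftrightarrow B}$ (with $\mathbb{X}=X\times B$, $\mathbb{Y}=A$), and $\mathbb{K}$-inf-compactness of $f^\sharp$ is with respect to $\Phi_A$ (with $\mathbb{X}=X$, $\mathbb{Y}=A$). *)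

theory Defs
  imports "HOL-Analysis.Analysis"
begin

text \<open>
  The metric spaces are carrier sets \<open>X\<close>, \<open>Y\<close>, ... inside types of class \<^class>\<open>metric_space\<close>,
  with the induced metric; neighbourhoods are taken in the subspace.  A multifunction is a
  set-valued function on the whole type, of which only the values on the carrier matter.
  Its graph over the carrier \<open>X\<close> is \<open>Sigma X F\<close>.
\<close>

definition mf_dom :: "'x set \<Rightarrow> ('x \<Rightarrow> 'y set) \<Rightarrow> 'x set" where
  "mf_dom X F = {x \<in> X. F x \<noteq> {}}"

definition nonempty_valued :: "'x set \<Rightarrow> 'y set \<Rightarrow> ('x \<Rightarrow> 'y set) \<Rightarrow> bool" where
  "nonempty_valued X Y F \<longleftrightarrow> (\<forall>x\<in>X. F x \<subseteq> Y \<and> F x \<noteq> {})"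

definition nbhd :: "'x::metric_space set \<Rightarrow> 'x set \<Rightarrow> 'x set \<Rightarrow> bool" where
  "nbhd X S N \<longleftrightarrow> N \<subseteq> X \<and> (\<exists>V. openin (top_of_set X) V \<and> S \<subseteq> V \<and> V \<subseteq> N)"

text \<open>The pointwise notions below are meant for points of \<open>mf_dom X F\<close> only.\<close>

definition mf_usc_at ::
  "'x::metric_space set \<Rightarrow> 'y::metric_space set \<Rightarrow> ('x \<Rightarrow> 'y set) \<Rightarrow> 'x \<Rightarrow> bool" where
  "mf_usc_at X Y F x \<longleftrightarrow>
     (\<forall>G. nbhd Y (F x) G \<longrightarrow>
        (\<exists>U. nbhd X {x} U \<and> (\<forall>z \<in> U \<inter> mf_dom X F. F z \<subseteq> G)))"

definition mf_lsc_at ::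
  "'x::metric_space set \<Rightarrow> 'y::metric_space set \<Rightarrow> ('x \<Rightarrow> 'y set) \<Rightarrow> 'x \<Rightarrow> bool" where
  "mf_lsc_at X Y F x \<longleftrightarrow>
     (\<forall>G. openin (top_of_set Y) G \<and> F x \<inter> G \<noteq> {} \<longrightarrow>
        (\<exists>U. nbhd X {x} U \<and> (\<forall>z \<in> U \<inter> mf_dom X F. F z \<inter> G \<noteq> {})))"

definition mf_usc :: "'x::metric_space set \<Rightarrow> 'y::metric_space set \<Rightarrow> ('x \<Rightarrow> 'y set) \<Rightarrow> bool" where
  "mf_usc X Y F \<longleftrightarrow> (\<forall>x \<in> mf_dom X F. mf_usc_at X Y F x)"

definition mf_lsc :: "'x::metric_space set \<Rightarrow> 'y::metric_space set \<Rightarrow> ('x \<Rightarrow> 'y set) \<Rightarrow> bool" where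
  "mf_lsc X Y F \<longleftrightarrow> (\<forall>x \<in> mf_dom X F. mf_lsc_at X Y F x)"

definition mf_continuous ::
  "'x::metric_space set \<Rightarrow> 'y::metric_space set \<Rightarrow> ('x \<Rightarrow> 'y set) \<Rightarrow> bool" where
  "mf_continuous X Y F \<longleftrightarrow> mf_lsc X Y F \<and> mf_usc X Y F"

definition A_lsc ::
  "'x::metric_space set \<Rightarrow> ('x \<Rightarrow> 'a set) \<Rightarrow> ('x \<times> 'a \<Rightarrow> 'b::metric_space set) \<Rightarrow> bool" where
  "A_lsc X \<Phi>A \<Phi>B \<longleftrightarrow>
     (\<forall>xs x as a b.
        (\<forall>n. xs n \<in> X) \<and> x \<in> X \<and> xs \<longlonglongrightarrow> x \<and>
        (\<forall>n::nat. as n \<in> \<Phi>A (xs n)) \<and> a \<in> \<Phi>A x \<and> b \<in> \<Phi>B (x, a) \<longrightarrow>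
        (\<exists>bs. (\<forall>n. bs n \<in> \<Phi>B (xs n, as n)) \<and>
              (\<exists>r::nat \<Rightarrow> nat. strict_mono r \<and> (bs \<circ> r) \<longlonglongrightarrow> b)))"

definition inf_compact_on :: "'s::metric_space set \<Rightarrow> ('s \<Rightarrow> ereal) \<Rightarrow> bool" where
  "inf_compact_on S g \<longleftrightarrow> (\<forall>t::real. compact {s \<in> S. g s \<le> ereal t})"

definition K_inf_compact ::
  "'x::metric_space set \<Rightarrow> ('x \<Rightarrow> 'y::metric_space set) \<Rightarrow> ('x \<times> 'y \<Rightarrow> ereal) \<Rightarrow> bool" where
  "K_inf_compact X F u \<longleftrightarrow>
     (\<forall>C. compact C \<and> C \<noteq> {} \<and> C \<subseteq> mf_dom X F \<longrightarrow> inf_compact_on (Sigma C F) u)"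

definition K_sup_compact ::
  "'x::metric_space set \<Rightarrow> ('x \<Rightarrow> 'y::metric_space set) \<Rightarrow> ('x \<times> 'y \<Rightarrow> ereal) \<Rightarrow> bool" where
  "K_sup_compact X F u \<longleftrightarrow> K_inf_compact X F (\<lambda>z. - u z)"

definition fun_lsc_at :: "'x::metric_space set \<Rightarrow> ('x \<Rightarrow> ereal) \<Rightarrow> 'x \<Rightarrow> bool" where
  "fun_lsc_at X g x \<longleftrightarrow> g x \<le> Liminf (at x within X) g"

definition worst_loss ::
  "('x \<times> 'a \<Rightarrow> 'b set) \<Rightarrow> (('x \<times> 'a) \<times> 'b \<Rightarrow> ereal) \<Rightarrow> 'x \<times> 'a \<Rightarrow> ereal" where
  "worst_loss \<Phi>B f p = (SUP b \<in> \<Phi>B p. f (p, b))"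

definition minimax_value ::
  "('x \<Rightarrow> 'a set) \<Rightarrow> ('x \<times> 'a \<Rightarrow> 'b set) \<Rightarrow> (('x \<times> 'a) \<times> 'b \<Rightarrow> ereal) \<Rightarrow> 'x \<Rightarrow> ereal" where
  "minimax_value \<Phi>A \<Phi>B f x = (INF a \<in> \<Phi>A x. worst_loss \<Phi>B f (x, a))"

definition solution_mf ::
  "('x \<Rightarrow> 'a set) \<Rightarrow> ('x \<times> 'a \<Rightarrow> 'b set) \<Rightarrow> (('x \<times> 'a) \<times> 'b \<Rightarrow> ereal) \<Rightarrow> 'x \<Rightarrow> 'a set" where
  "solution_mf \<Phi>A \<Phi>B f x =
     {a \<in> \<Phi>A x. minimax_value \<Phi>A \<Phi>B f x = worst_loss \<Phi>B f (x, a)}"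

definition swap_mf ::
  "('x \<Rightarrow> 'a set) \<Rightarrow> ('x \<times> 'a \<Rightarrow> 'b set) \<Rightarrow> 'x \<times> 'b \<Rightarrow> 'a set" where
  "swap_mf \<Phi>A \<Phi>B = (\<lambda>(x, b). {a \<in> \<Phi>A x. b \<in> \<Phi>B (x, a)})"

definition swap_fun :: "(('x \<times> 'a) \<times> 'b \<Rightarrow> 'c) \<Rightarrow> ('x \<times> 'b) \<times> 'a \<Rightarrow> 'c" where
  "swap_fun f = (\<lambda>((x, b), a). f ((x, a), b))"


text \<open>Below, the carriers exclude \<open>a < 0\<close>; values there are irrelevant.\<close>

definition X0 :: "real set" where "X0 = UNIV"
definition A0 :: "real set" where "A0 = {0..}"
definition B0 :: "real set" where "B0 = {0..}"

definition \<Phi>A0 :: "real \<Rightarrow> real set" where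
  "\<Phi>A0 x = {0..}"

definition \<phi>B0 :: "real \<Rightarrow> real \<Rightarrow> real" where
  "\<phi>B0 x a =
     (if x \<le> 0 \<or> (0 < x \<and> 0 \<le> a \<and> a < 1 / (2 * x)) then 0
      else if 0 < x \<and> 1 / (2 * x) \<le> a \<and> a \<le> 1 / x then 2 * (2 * x + 1) * a - 2 - 1 / x
      else 2 + 1 / x)"

definition \<Phi>B0 :: "real \<times> real \<Rightarrow> real set" where
  "\<Phi>B0 = (\<lambda>(x, a). {\<phi>B0 x a..})"

definition f0 :: "(real \<times> real) \<times> real \<Rightarrow> real" where
  "f0 = (\<lambda>((x, a), b).
     (if x \<le> 0 \<or> (0 < x \<and> 0 \<le> a \<and> a < 1 / (2 * x)) then 1 + a - b
      else if 0 < x \<and> 1 / (2 * x) \<le> a \<and> a \<le> 1 / x then (2 * x + 1) * a - b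
      else 2 + a - b))"

definition f0_ereal :: "(real \<times> real) \<times> real \<Rightarrow> ereal" where
  "f0_ereal z = ereal (f0 z)"

end

theory Submission
  imports Defs
begin

text \<open>
  With \<open>r = ramp x a\<close>, the function \<open>2 x a - 1\<close> truncated to \<open>[0,1]\<close>, all the piecewise
  definitions collapse on \<open>a \<ge> 0\<close>: \<open>\<phi>B0 x a = r (2 + 1/x)\<close> and
  \<open>f0 ((x,a),b) = 1 + a + r - b\<close>.  The only delicate continuity is that of \<open>\<phi>B0\<close> at \<open>x = 0\<close>, where
  it vanishes on the relatively open set \<open>2 x a < 1\<close>.  As \<open>x\<close> tends to \<open>0\<close> from the right, the
  transition zone \<open>1/(2x) \<le> a \<le> 1/x\<close>, beyond which \<open>\<phi>B0 > 2\<close> and at whose right end the loss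
  vanishes, escapes to infinity: this is behind all the negative claims.
\<close>

section \<open>Closed forms of the data through the ramp\<close>

definition ramp :: "real \<Rightarrow> real \<Rightarrow> real" where
  "ramp x a = max 0 (min 1 (2 * x * a - 1))"

lemma ramp_ge_0: "0 \<le> ramp x a"
  by (simp add: ramp_def)

lemma ramp_eq_0: "2 * x * a \<le> 1 \<Longrightarrow> ramp x a = 0"
  by (simp add: ramp_def)

text \<open>The case facts are phrased as the very guards of the conditionals in
  \<open>\<phi>B0_def\<close> and \<open>f0_def\<close>, so that simplification can decide those
  conditionals. In \<open>high\<close>, the bound \<open>1 / (2 * x) \<le> a\<close> refutes the
  first guard.\<close>

lemma ramp_cases:
  fixes x a :: real
  assumes "0 \<le> a"
  obtains
    (low) "x \<le> 0 \<or> (0 < x \<and> 0 \<le> a \<and> a < 1 / (2 * x))" "ramp x a = 0"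
  | (mid) "0 < x" "1 / (2 * x) \<le> a" "a \<le> 1 / x" "ramp x a = 2 * x * a - 1"
  | (high) "0 < x" "1 / (2 * x) \<le> a" "1 / x < a" "ramp x a = 1"
proof -
  consider "x \<le> 0" | "0 < x" "a < 1 / (2 * x)"
    | "0 < x" "1 / (2 * x) \<le> a" "a \<le> 1 / x" | "0 < x" "1 / (2 * x) \<le> a" "1 / x < a"
    by linarith
  then show thesis
  proof cases
    case 1
    then have "x * a \<le> 0"
      using assms by (simp add: mult_nonpos_nonneg)
    with 1 show thesis by (intro low) (auto simp: ramp_def)
  next
    case 2
    then show thesis using assms by (intro low) (auto simp: ramp_def field_simps)
  next
    case 3
    then show thesis by (intro mid) (auto simp: ramp_def field_simps)
  next
    case 4
    then show thesis by (intro high) (auto simp: ramp_def field_simps)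
  qed
qed

text \<open>On the middle zone \<open>(2 * x * a - 1) * (2 + 1 / x)\<close> expands to the affine
  branch; on the outer zones the factor is 0 or 1. For \<open>x \<le> 0\<close> the ramp vanishes,
  so the convention \<open>1 / 0 = 0\<close> is harmless.\<close>

lemma \<phi>B0_eq_ramp:
  assumes "0 \<le> a"
  shows "\<phi>B0 x a = ramp x a * (2 + 1 / x)"
  using assms
proof (cases rule: ramp_cases[where x = x])
  case mid
  then show ?thesis unfolding \<phi>B0_def mid(4) by (auto simp: field_simps)
qed (auto simp: \<phi>B0_def)

lemma f0_eq_ramp:
  assumes "0 \<le> a"
  shows "f0 ((x, a), b) = 1 + a + ramp x a - b"
  using assms
proof (cases rule: ramp_cases[where x = x])
  case mid
  then show ?thesis by (auto simp: f0_def algebra_simps)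
qed (auto simp: f0_def)

lemma \<phi>B0_nonneg: "0 \<le> a \<Longrightarrow> 0 \<le> \<phi>B0 x a"
  by (cases "x \<le> 0") (simp add: \<phi>B0_def, simp add: \<phi>B0_eq_ramp ramp_ge_0)

text \<open>Continuity is local, so two relatively open pieces suffice: on
  \<open>2 * x * a < 1\<close> the function is zero, and on \<open>0 < x\<close> the closed form is
  continuous because \<open>1 / x\<close> is. They cover the half-plane, since
  \<open>x \<le> 0\<close> and \<open>0 \<le> a\<close> give
  \<open>2 * x * a \<le> 0\<close>.\<close>

lemma continuous_on_\<phi>B0: "continuous_on (UNIV \<times> {0..}) (\<lambda>p. \<phi>B0 (fst p) (snd p))"
proof -
  let ?D = "UNIV \<times> {0..} :: (real \<times> real) set"
  let ?L = "?D \<inter> {p. 2 * fst p * snd p < 1}" and ?R = "?D \<inter> {p. 0 < fst p}"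
  have cover: "?L \<union> ?R = ?D"
  proof -
    have "2 * x * a < 1" if "x \<le> 0" "0 \<le> a" for x a :: real
      using mult_nonpos_nonneg[OF that] by simp
    then show ?thesis by (auto simp: not_less)
  qed
  have "open {p :: real \<times> real. 2 * fst p * snd p < 1}" "open {p :: real \<times> real. 0 < fst p}"
    by (intro open_Collect_less continuous_intros)+
  then have opn: "openin (top_of_set ?D) ?L" "openin (top_of_set ?D) ?R"
    by (auto intro: openin_open_Int)
  have "continuous_on ?L (\<lambda>p. \<phi>B0 (fst p) (snd p))"
    by (rule continuous_on_eq[of _ "\<lambda>_. 0"]) (auto simp: \<phi>B0_eq_ramp ramp_eq_0)
  moreover have "continuous_on ?R (\<lambda>p. \<phi>B0 (fst p) (snd p))"
  proof (rule continuous_on_eq)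
    show "continuous_on ?R (\<lambda>p. ramp (fst p) (snd p) * (2 + 1 / fst p))"
      unfolding ramp_def by (intro continuous_intros) auto
  qed (auto simp: \<phi>B0_eq_ramp)
  ultimately show ?thesis
    using continuous_on_Un_local_open[of ?L ?R] opn unfolding cover by blast
qed

section \<open>Worst loss, minimax value and solution set\<close>

text \<open>The loss decreases in \<open>b\<close>, so the supremum over the ray is attained at its
  left endpoint \<open>\<phi>B0 x a\<close>.\<close>

lemma worst_loss_eq:
  assumes "0 \<le> a"
  shows "worst_loss \<Phi>B0 f0_ereal (x, a) = ereal (1 + a + ramp x a - \<phi>B0 x a)"
  unfolding worst_loss_def
proof (rule antisym)
  show "(SUP b\<in>\<Phi>B0 (x, a). f0_ereal ((x, a), b)) \<le> ereal (1 + a + ramp x a - \<phi>B0 x a)"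
    by (intro SUP_least) (auto simp: \<Phi>B0_def f0_ereal_def f0_eq_ramp assms)
  show "ereal (1 + a + ramp x a - \<phi>B0 x a) \<le> (SUP b\<in>\<Phi>B0 (x, a). f0_ereal ((x, a), b))"
    by (intro SUP_upper2[of "\<phi>B0 x a"]) (auto simp: \<Phi>B0_def f0_ereal_def f0_eq_ramp assms)
qed

lemma worst_loss_piecewise:
  assumes "0 \<le> a"
  shows "worst_loss \<Phi>B0 f0_ereal (x, a) = ereal
          (if x \<le> 0 \<or> (0 < x \<and> 0 \<le> a \<and> a < 1 / (2 * x)) then 1 + a
           else if 0 < x \<and> 1 / (2 * x) \<le> a \<and> a \<le> 1 / x then (2 * x + 1) * (1 / x - a)
           else a - 1 / x)"
  using assms
proof (cases rule: ramp_cases[where x = x])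
  case mid
  then show ?thesis unfolding worst_loss_eq[OF assms] \<phi>B0_eq_ramp[OF assms] mid(4)
    by (auto simp: field_simps)
qed (auto simp: worst_loss_eq assms \<phi>B0_eq_ramp)

lemma worst_loss_nonpos: "x \<le> 0 \<Longrightarrow> 0 \<le> a \<Longrightarrow> worst_loss \<Phi>B0 f0_ereal (x, a) = ereal (1 + a)"
  by (simp add: worst_loss_piecewise)

text \<open>The first branch is at least 1, the middle one is a positive factor times
  \<open>1 / x - a\<close>, and the last is positive. Hence \<open>1 / x\<close> is the unique
  minimizer for \<open>x > 0\<close>.\<close>

lemma worst_loss_pos:
  assumes "0 < x" "0 \<le> a"
  shows "0 \<le> worst_loss \<Phi>B0 f0_ereal (x, a)"
    and "worst_loss \<Phi>B0 f0_ereal (x, a) = 0 \<longleftrightarrow> a = 1 / x"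
proof -
  show "0 \<le> worst_loss \<Phi>B0 f0_ereal (x, a)"
    using assms by (auto simp: worst_loss_piecewise zero_ereal_def)
  \<comment> \<open>This places \<open>a = 1 / x\<close> in the middle branch rather than the
    first.\<close>
  have "1 / (2 * x) < 1 / x"
    using assms by (simp add: field_simps)
  then show "worst_loss \<Phi>B0 f0_ereal (x, a) = 0 \<longleftrightarrow> a = 1 / x"
    using assms unfolding worst_loss_piecewise[OF assms(2)] zero_ereal_def by auto
qed

lemma minimax_value_nonpos:
  assumes "x \<le> 0"
  shows "minimax_value \<Phi>A0 \<Phi>B0 f0_ereal x = 1"
  unfolding minimax_value_def
proof (rule antisym)
  show "(INF a\<in>\<Phi>A0 x. worst_loss \<Phi>B0 f0_ereal (x, a)) \<le> 1"
    by (rule INF_lower2[of 0]) (auto simp: \<Phi>A0_def worst_loss_nonpos assms one_ereal_def)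
  show "1 \<le> (INF a\<in>\<Phi>A0 x. worst_loss \<Phi>B0 f0_ereal (x, a))"
    by (rule INF_greatest) (auto simp: \<Phi>A0_def worst_loss_nonpos assms one_ereal_def)
qed

lemma minimax_value_pos:
  assumes "0 < x"
  shows "minimax_value \<Phi>A0 \<Phi>B0 f0_ereal x = 0"
  unfolding minimax_value_def
proof (rule antisym)
  show "(INF a\<in>\<Phi>A0 x. worst_loss \<Phi>B0 f0_ereal (x, a)) \<le> 0"
    using assms worst_loss_pos(2)[of x "1 / x"]
    by (intro INF_lower2[of "1 / x"]) (auto simp: \<Phi>A0_def)
  show "0 \<le> (INF a\<in>\<Phi>A0 x. worst_loss \<Phi>B0 f0_ereal (x, a))"
    by (rule INF_greatest) (auto simp: \<Phi>A0_def worst_loss_pos assms)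
qed

lemma solution_mf_eq:
  "solution_mf \<Phi>A0 \<Phi>B0 f0_ereal x = (if x \<le> 0 then {0} else {1 / x})"
proof (cases "x \<le> 0")
  case True
  then show ?thesis
    by (auto simp: solution_mf_def minimax_value_nonpos \<Phi>A0_def worst_loss_nonpos one_ereal_def)
next
  case False
  then have "a \<in> solution_mf \<Phi>A0 \<Phi>B0 f0_ereal x \<longleftrightarrow> a = 1 / x" for a
    using worst_loss_pos(2)[of x a]
    by (auto simp: solution_mf_def minimax_value_pos \<Phi>A0_def)
  with False show ?thesis by auto
qed

section \<open>Semi-continuity of the multifunctions\<close>

lemma nbhd_openin: "openin (top_of_set X) U \<Longrightarrow> S \<subseteq> U \<Longrightarrow> nbhd X S U"
  unfolding nbhd_def using openin_imp_subset by blast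

lemma mf_continuous_const: "mf_continuous X Y (\<lambda>_. S)"
  unfolding mf_continuous_def mf_lsc_def mf_usc_def mf_lsc_at_def mf_usc_at_def
proof (intro conjI ballI allI impI)
  fix x G assume x: "x \<in> mf_dom X (\<lambda>_. S)"
  then have U: "nbhd X {x} X"
    by (auto simp: mf_dom_def intro: nbhd_openin)
  show "\<exists>U. nbhd X {x} U \<and> (\<forall>z\<in>U \<inter> mf_dom X (\<lambda>_. S). S \<inter> G \<noteq> {})"
    if "openin (top_of_set Y) G \<and> S \<inter> G \<noteq> {}"
    using U that by blast
  show "\<exists>U. nbhd X {x} U \<and> (\<forall>z\<in>U \<inter> mf_dom X (\<lambda>_. S). S \<subseteq> G)" if "nbhd Y S G"
    using U that unfolding nbhd_def by blast
qed

text \<open>A ray varies only through its endpoint, so both conditions become strict one-sided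
  bounds on \<open>g z\<close>: an upper bound for lower semi-continuity, a lower bound for upper
  semi-continuity. Each defines an open preimage.\<close>

lemma mf_continuous_atLeast:
  fixes g :: "'x::metric_space \<Rightarrow> real"
  assumes cont: "continuous_on X g" and nonneg: "\<And>x. x \<in> X \<Longrightarrow> 0 \<le> g x"
  shows "mf_continuous X {0..} (\<lambda>x. {g x..})"
  unfolding mf_continuous_def mf_lsc_def mf_usc_def mf_lsc_at_def mf_usc_at_def
proof (intro conjI ballI allI impI)
  fix x G
  assume "x \<in> mf_dom X (\<lambda>x. {g x..})" and G: "openin (top_of_set {0..}) G \<and> {g x..} \<inter> G \<noteq> {}"
  then have x: "x \<in> X" by (simp add: mf_dom_def)
  from G obtain b where b: "b \<in> G" "g x \<le> b" by auto
  with G obtain e where e: "0 < e" "\<And>c. c \<in> {0..} \<Longrightarrow> dist c b < e \<Longrightarrow> c \<in> G"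
    unfolding openin_euclidean_subtopology_iff by blast
  \<comment> \<open>The point \<open>b\<close> may coincide with the endpoint \<open>g x\<close>.
    Shifting it up inside \<open>G\<close> makes the inequality with \<open>g x\<close> strict,
    hence stable near \<open>x\<close>.\<close>
  have c: "b + e / 2 \<in> G"
    using e nonneg[OF x] b by (intro e(2)) (auto simp: dist_real_def)
  define U where "U = X \<inter> g -` {..< b + e / 2}"
  have "openin (top_of_set X) U"
    unfolding U_def by (intro continuous_openin_preimage_gen cont) auto
  then have "nbhd X {x} U"
    using x b e by (intro nbhd_openin) (auto simp: U_def)
  moreover have "{g z..} \<inter> G \<noteq> {}" if "z \<in> U" for z
    using that c by (auto simp: U_def intro!: exI[of _ "b + e / 2"] simp flip: ex_in_conv)
  ultimately show "\<exists>U. nbhd X {x} U \<and> (\<forall>z\<in>U \<inter> mf_dom X (\<lambda>x. {g x..}). {g z..} \<inter> G \<noteq> {})"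
    by blast
next
  fix x G
  assume "x \<in> mf_dom X (\<lambda>x. {g x..})" and G: "nbhd {0..} {g x..} G"
  then have x: "x \<in> X" by (simp add: mf_dom_def)
  from G obtain V where V: "openin (top_of_set {0..}) V" "{g x..} \<subseteq> V" "V \<subseteq> G"
    by (auto simp: nbhd_def)
  then obtain e where e: "0 < e" "\<And>c. c \<in> {0..} \<Longrightarrow> dist c (g x) < e \<Longrightarrow> c \<in> V"
    unfolding openin_euclidean_subtopology_iff by (metis atLeast_iff order_refl subsetD)
  \<comment> \<open>Everything from \<open>g x\<close> upwards already lies in \<open>V\<close>, and
    so do carrier points less than \<open>e\<close> below \<open>g x\<close>; the endpoint may thus
    drop by less than \<open>e\<close>.\<close>
  define U where "U = X \<inter> g -` {g x - e <..}"
  have "openin (top_of_set X) U"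
    unfolding U_def by (intro continuous_openin_preimage_gen cont) auto
  then have "nbhd X {x} U"
    using x e by (intro nbhd_openin) (auto simp: U_def)
  moreover have "{g z..} \<subseteq> G" if "z \<in> U" for z
  proof
    fix c assume "c \<in> {g z..}"
    then have "0 \<le> c" "g x - e < c"
      using that nonneg[of z] by (auto simp: U_def)
    then have "c \<in> V"
      using e(2)[of c] V(2) by (cases "g x \<le> c") (auto simp: dist_real_def)
    with V show "c \<in> G" by auto
  qed
  ultimately show "\<exists>U. nbhd X {x} U \<and> (\<forall>z\<in>U \<inter> mf_dom X (\<lambda>x. {g x..}). {g z..} \<subseteq> G)"
    by blast
qed

lemma continuous_on_\<phi>B0_comp:
  assumes "continuous_on S g" "continuous_on S h" "\<And>z. z \<in> S \<Longrightarrow> 0 \<le> h z"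
  shows "continuous_on S (\<lambda>z. \<phi>B0 (g z) (h z))"
proof -
  have "continuous_on S (\<lambda>z. (g z, h z))"
    using assms by (intro continuous_intros)
  from continuous_on_compose2[OF continuous_on_\<phi>B0 this] show ?thesis
    using assms(3) by auto
qed

lemma mf_continuous_\<Phi>B0: "mf_continuous (Sigma X0 \<Phi>A0) B0 \<Phi>B0"
proof -
  have "mf_continuous (Sigma X0 \<Phi>A0) {0..} (\<lambda>p. {\<phi>B0 (fst p) (snd p)..})"
    by (intro mf_continuous_atLeast continuous_on_\<phi>B0_comp continuous_intros)
      (auto simp: \<Phi>A0_def intro: \<phi>B0_nonneg)
  moreover have "\<Phi>B0 = (\<lambda>p. {\<phi>B0 (fst p) (snd p)..})"
    by (auto simp: \<Phi>B0_def)
  ultimately show ?thesis by (simp add: B0_def)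
qed

text \<open>The value \<open>b = 0\<close> is admissible at \<open>(0, 0)\<close>, but along
  unbounded actions beyond the transition zone every admissible \<open>b\<close> is at least 2, so
  no subsequence tends to 0.\<close>

lemma not_A_lsc_\<Phi>B0: "\<not> A_lsc X0 \<Phi>A0 \<Phi>B0"
proof
  assume A: "A_lsc X0 \<Phi>A0 \<Phi>B0"
  \<comment> \<open>Here \<open>as n = 2 / xs n\<close>, twice the right end of the transition
    zone.\<close>
  define xs as where "xs n = 1 / real (Suc n)" and "as n = 2 * real (Suc n)" for n
  have "xs \<longlonglongrightarrow> 0"
    unfolding xs_def using LIMSEQ_inverse_real_of_nat by (simp add: inverse_eq_divide)
  then have "\<exists>bs. (\<forall>n. bs n \<in> \<Phi>B0 (xs n, as n)) \<and> (\<exists>r::nat \<Rightarrow> nat. strict_mono r \<and> (bs \<circ> r) \<longlonglongrightarrow> 0)"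
    using A[unfolded A_lsc_def, rule_format, of xs 0 as 0 0]
    by (auto simp: X0_def \<Phi>A0_def as_def \<Phi>B0_def \<phi>B0_def)
  then obtain bs and r :: "nat \<Rightarrow> nat" where
    bs: "\<And>n. bs n \<in> \<Phi>B0 (xs n, as n)" and lim: "(bs \<circ> r) \<longlonglongrightarrow> 0"
    by blast
  have "2 \<le> bs n" for n
  proof -
    have "2 * xs n * as n = 4"
      by (simp add: xs_def as_def field_simps)
    then have "ramp (xs n) (as n) = 1"
      by (simp only: ramp_def)
    then have "2 \<le> \<phi>B0 (xs n) (as n)"
      by (simp add: \<phi>B0_eq_ramp as_def xs_def)
    with bs[of n] show ?thesis by (auto simp: \<Phi>B0_def)
  qed
  then have "2 \<le> (0::real)"
    using lim by (intro LIMSEQ_le_const[OF lim]) auto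
  then show False by simp
qed

section \<open>Compact level sets and continuity of the loss\<close>

text \<open>Serves to cut a level set out of a compact box in two stages: first by the constraint
  \<open>\<phi>B0 x a \<le> b\<close>, then by the bound on the loss.\<close>

lemma compact_Collect_le:
  fixes g h :: "'a::metric_space \<Rightarrow> real"
  assumes "compact K" "continuous_on K g" "continuous_on K h"
  shows "compact {z \<in> K. g z \<le> h z}"
proof -
  have "closedin (top_of_set K) (K \<inter> (\<lambda>z. h z - g z) -` {0..})"
    by (intro continuous_closedin_preimage continuous_intros assms)
  moreover have "K \<inter> (\<lambda>z. h z - g z) -` {0..} = {z \<in> K. g z \<le> h z}"
    by auto
  ultimately show ?thesis
    using closedin_compact assms(1) by metis
qed

text \<open>With \<open>b\<close> bounded by \<open>M\<close> on \<open>C\<close> and the ramp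
  nonnegative, a loss of at most \<open>t\<close> forces \<open>a \<le> t + M\<close>. The level set
  is therefore a closed part of a compact box.\<close>

lemma K_inf_compact_swap_f0: "K_inf_compact (X0 \<times> B0) (swap_mf \<Phi>A0 \<Phi>B0) (swap_fun f0_ereal)"
  unfolding K_inf_compact_def inf_compact_on_def
proof (intro allI impI)
  fix C :: "(real \<times> real) set" and t :: real
  assume C: "compact C \<and> C \<noteq> {} \<and> C \<subseteq> mf_dom (X0 \<times> B0) (swap_mf \<Phi>A0 \<Phi>B0)"
  then have "bounded (snd ` C)"
    by (intro compact_imp_bounded compact_continuous_image continuous_intros) auto
  then obtain M where M: "\<And>x b. (x, b) \<in> C \<Longrightarrow> \<bar>b\<bar> \<le> M"
    by (force simp: bounded_iff)
  define K where "K = C \<times> {0..t + M}"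
  have K: "compact K"
    unfolding K_def using C by (intro compact_Times) auto
  define K' where "K' = {z \<in> K. \<phi>B0 (fst (fst z)) (snd z) \<le> snd (fst z)}"
  have K': "compact K'"
    unfolding K'_def
    by (intro compact_Collect_le K continuous_on_\<phi>B0_comp continuous_intros) (auto simp: K_def)
  have "compact {z \<in> K'. 1 + snd z + ramp (fst (fst z)) (snd z) - snd (fst z) \<le> t}"
    unfolding ramp_def by (intro compact_Collect_le K' continuous_intros)
  also have "{z \<in> K'. 1 + snd z + ramp (fst (fst z)) (snd z) - snd (fst z) \<le> t} =
    {z \<in> Sigma C (swap_mf \<Phi>A0 \<Phi>B0). swap_fun f0_ereal z \<le> ereal t}"
  proof -
    have "a \<le> t + M" if "(x, b) \<in> C" "1 + a + ramp x a - b \<le> t" for x a b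
      using M[OF that(1)] that(2) ramp_ge_0[of x a] by linarith
    then show ?thesis
      by (auto simp: K'_def K_def swap_mf_def swap_fun_def f0_ereal_def f0_eq_ramp \<Phi>A0_def \<Phi>B0_def)
  qed
  finally show "compact {z \<in> Sigma C (swap_mf \<Phi>A0 \<Phi>B0). swap_fun f0_ereal z \<le> ereal t}" .
qed

lemma K_sup_compact_f0: "K_sup_compact (X0 \<times> A0) \<Phi>B0 f0_ereal"
  unfolding K_sup_compact_def K_inf_compact_def inf_compact_on_def
proof (intro allI impI)
  fix C :: "(real \<times> real) set" and t :: real
  assume C: "compact C \<and> C \<noteq> {} \<and> C \<subseteq> mf_dom (X0 \<times> A0) \<Phi>B0"
  then have nonneg: "0 \<le> a" if "(x, a) \<in> C" for x a
    using that by (auto simp: mf_dom_def A0_def)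
  from C have "bounded (snd ` C)"
    by (intro compact_imp_bounded compact_continuous_image continuous_intros) auto
  then obtain M where M: "\<And>x a. (x, a) \<in> C \<Longrightarrow> \<bar>a\<bar> \<le> M"
    by (force simp: bounded_iff)
  \<comment> \<open>The bound on the negated loss reads \<open>b \<le> t + 1 + a + ramp x a\<close>;
    the summand 2 absorbs the constant 1 and the ramp, which is at most 1. The lower end 0 comes
    from \<open>\<phi>B0_nonneg\<close>.\<close>
  define K where "K = C \<times> {0..t + M + 2}"
  have K: "compact K"
    unfolding K_def using C by (intro compact_Times) auto
  define K' where "K' = {z \<in> K. \<phi>B0 (fst (fst z)) (snd (fst z)) \<le> snd z}"
  have K': "compact K'"
    unfolding K'_def
    by (intro compact_Collect_le K continuous_on_\<phi>B0_comp continuous_intros)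
      (auto simp: K_def nonneg)
  have "compact {z \<in> K'. - (1 + snd (fst z) + ramp (fst (fst z)) (snd (fst z)) - snd z) \<le> t}"
    unfolding ramp_def by (intro compact_Collect_le K' continuous_intros)
  also have "{z \<in> K'. - (1 + snd (fst z) + ramp (fst (fst z)) (snd (fst z)) - snd z) \<le> t} =
    {z \<in> Sigma C \<Phi>B0. - f0_ereal z \<le> ereal t}"
  proof -
    have up: "b \<le> t + M + 2" if "(x, a) \<in> C" "- (1 + a + ramp x a - b) \<le> t" for x a b
      using M[OF that(1)] that(2) by (simp add: ramp_def)
    have lo: "0 \<le> b" if "(x, a) \<in> C" "\<phi>B0 x a \<le> b" for x a b
      using \<phi>B0_nonneg[OF nonneg[OF that(1)], of x] that(2) by linarith
    have f: "- f0_ereal ((x, a), b) \<le> ereal t \<longleftrightarrow> - (1 + a + ramp x a - b) \<le> t"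
      if "(x, a) \<in> C" for x a b
      by (simp add: f0_ereal_def f0_eq_ramp nonneg[OF that])
    show ?thesis
    proof (rule set_eqI, clarify)
      fix x a b
      show "((x, a), b) \<in> {z \<in> K'. - (1 + snd (fst z) + ramp (fst (fst z)) (snd (fst z)) - snd z) \<le> t}
        \<longleftrightarrow> ((x, a), b) \<in> {z \<in> Sigma C \<Phi>B0. - f0_ereal z \<le> ereal t}"
      proof (cases "(x, a) \<in> C")
        case True
        then show ?thesis
          using up[OF True, of b] lo[OF True, of b] f[OF True, of b]
          by (auto simp: K'_def K_def \<Phi>B0_def)
      qed (simp add: K'_def K_def)
    qed
  qed
  finally show "compact {z \<in> Sigma C \<Phi>B0. - f0_ereal z \<le> ereal t}" .
qed

text \<open>Read off directly from the ramp form, which is free of case distinctions, rather than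
  deduced from the compactness properties.\<close>

lemma continuous_on_f0: "continuous_on (Sigma (Sigma X0 \<Phi>A0) \<Phi>B0) f0"
proof (rule continuous_on_eq)
  show "continuous_on (Sigma (Sigma X0 \<Phi>A0) \<Phi>B0)
      (\<lambda>z. 1 + snd (fst z) + ramp (fst (fst z)) (snd (fst z)) - snd z)"
    unfolding ramp_def by (intro continuous_intros)
qed (auto simp: \<Phi>A0_def f0_eq_ramp)

lemma continuous_on_swap_f0:
  "continuous_on (Sigma (X0 \<times> B0) (swap_mf \<Phi>A0 \<Phi>B0)) (swap_fun f0)"
proof (rule continuous_on_eq)
  show "continuous_on (Sigma (X0 \<times> B0) (swap_mf \<Phi>A0 \<Phi>B0))
      (\<lambda>z. 1 + snd z + ramp (fst (fst z)) (snd z) - snd (fst z))"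
    unfolding ramp_def by (intro continuous_intros)
qed (auto simp: \<Phi>A0_def f0_eq_ramp swap_mf_def swap_fun_def)

lemma continuous_on_worst_loss: "continuous_on (Sigma X0 \<Phi>A0) (worst_loss \<Phi>B0 f0_ereal)"
proof (rule continuous_on_eq)
  show "continuous_on (Sigma X0 \<Phi>A0)
      (\<lambda>p. ereal (1 + snd p + ramp (fst p) (snd p) - \<phi>B0 (fst p) (snd p)))"
    unfolding ramp_def
    by (intro continuous_on_ereal continuous_on_diff continuous_on_\<phi>B0_comp continuous_intros)
      (auto simp: \<Phi>A0_def)
qed (auto simp: \<Phi>A0_def worst_loss_eq)

section \<open>Failures caused by the escaping minimizers\<close>

text \<open>Over the compact set \<open>{0..1}\<close> the level set at 0 contains the unbounded
  curve of zeros \<open>(1 / a, a)\<close> with \<open>a \<ge> 1\<close>.\<close>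

lemma not_K_inf_compact_worst_loss: "\<not> K_inf_compact X0 \<Phi>A0 (worst_loss \<Phi>B0 f0_ereal)"
proof
  assume "K_inf_compact X0 \<Phi>A0 (worst_loss \<Phi>B0 f0_ereal)"
  then have "inf_compact_on (Sigma {0..1} \<Phi>A0) (worst_loss \<Phi>B0 f0_ereal)"
    by (auto simp: K_inf_compact_def mf_dom_def X0_def \<Phi>A0_def)
  then have "compact {s \<in> Sigma {0..1} \<Phi>A0. worst_loss \<Phi>B0 f0_ereal s \<le> ereal 0}" (is "compact ?S")
    unfolding inf_compact_on_def by blast
  then have "bounded (snd ` ?S)"
    by (intro compact_imp_bounded compact_continuous_image continuous_intros)
  then obtain M where M: "\<And>p. p \<in> ?S \<Longrightarrow> \<bar>snd p\<bar> \<le> M"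
    by (force simp: bounded_iff)
  \<comment> \<open>This exceeds \<open>M\<close> and is at least 1, which keeps
    \<open>1 / a\<close> in \<open>{0..1}\<close>.\<close>
  define a where "a = \<bar>M\<bar> + 1"
  have "worst_loss \<Phi>B0 f0_ereal (1 / a, a) = 0"
    using worst_loss_pos(2)[of "1 / a" a] by (simp add: a_def)
  then have "(1 / a, a) \<in> ?S"
    by (auto simp: \<Phi>A0_def a_def)
  from M[OF this] show False by (simp add: a_def)
qed

lemma not_fun_lsc_minimax_value: "\<not> fun_lsc_at X0 (minimax_value \<Phi>A0 \<Phi>B0 f0_ereal) 0"
proof
  assume "fun_lsc_at X0 (minimax_value \<Phi>A0 \<Phi>B0 f0_ereal) 0"
  then have "1 \<le> Liminf (at 0) (minimax_value \<Phi>A0 \<Phi>B0 f0_ereal)"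
    by (simp add: fun_lsc_at_def X0_def minimax_value_nonpos)
  then have "eventually (\<lambda>x. 0 < minimax_value \<Phi>A0 \<Phi>B0 f0_ereal x) (at 0)"
    unfolding le_Liminf_iff by simp
  \<comment> \<open>Left of 0 the value is 1, so only the right-hand filter, which is nontrivial,
    can yield the contradiction.\<close>
  then have "eventually (\<lambda>x. 0 < minimax_value \<Phi>A0 \<Phi>B0 f0_ereal x) (at_right 0)"
    by (simp add: eventually_at_split)
  moreover have "eventually (\<lambda>x::real. 0 < x) (at_right 0)"
    by (rule eventually_at_right_less)
  ultimately have "eventually (\<lambda>x::real. False) (at_right 0)"
    by eventually_elim (simp add: minimax_value_pos)
  then show False by simp
qed

lemma not_mf_usc_solution: "\<not> mf_usc_at X0 A0 (solution_mf \<Phi>A0 \<Phi>B0 f0_ereal) 0"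
proof
  assume "mf_usc_at X0 A0 (solution_mf \<Phi>A0 \<Phi>B0 f0_ereal) 0"
  \<comment> \<open>The set \<open>[0, 1)\<close> is a neighbourhood of the solution set
    \<open>{0}\<close> at 0, and it misses \<open>1 / x\<close> whenever
    \<open>0 < x \<le> 1\<close>.\<close>
  moreover have "openin (top_of_set A0) (A0 \<inter> {..<1})"
    by (auto intro: openin_open_Int)
  then have "nbhd A0 (solution_mf \<Phi>A0 \<Phi>B0 f0_ereal 0) (A0 \<inter> {..<1})"
    by (intro nbhd_openin) (auto simp: solution_mf_eq A0_def)
  ultimately obtain U where "nbhd X0 {0} U"
    and U: "\<And>z. z \<in> U \<Longrightarrow> z \<in> mf_dom X0 (solution_mf \<Phi>A0 \<Phi>B0 f0_ereal) \<Longrightarrow>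
      solution_mf \<Phi>A0 \<Phi>B0 f0_ereal z \<subseteq> A0 \<inter> {..<1}"
    unfolding mf_usc_at_def by blast
  then obtain V where V: "open V" "0 \<in> V" "V \<subseteq> U"
    by (auto simp: nbhd_def X0_def)
  then obtain e where e: "0 < e" "ball 0 e \<subseteq> V"
    by (auto simp: open_contains_ball)
  \<comment> \<open>The cap 1 makes \<open>1 / x \<ge> 1\<close>, and \<open>e / 2\<close> keeps
    \<open>x\<close> in the ball.\<close>
  define x where "x = min 1 (e / 2)"
  have x: "0 < x" "x \<le> 1" "x \<in> ball 0 e"
    using e by (auto simp: x_def)
  moreover from x e V have "x \<in> U" by blast
  ultimately have "1 / x < 1"
    using U[of x] by (auto simp: mf_dom_def X0_def solution_mf_eq)
  with x show False by (simp add: field_simps)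
qed

theorem mainTheorem1:
  shows
   "(nonempty_valued X0 A0 \<Phi>A0 \<and> nonempty_valued (Sigma X0 \<Phi>A0) B0 \<Phi>B0 \<and>
     mf_continuous X0 A0 \<Phi>A0 \<and> mf_continuous (Sigma X0 \<Phi>A0) B0 \<Phi>B0 \<and>
     mf_lsc (Sigma X0 \<Phi>A0) B0 \<Phi>B0 \<and>
     \<not> A_lsc X0 \<Phi>A0 \<Phi>B0)
  \<and> (K_inf_compact (X0 \<times> B0) (swap_mf \<Phi>A0 \<Phi>B0) (swap_fun f0_ereal) \<and>
     K_sup_compact (X0 \<times> A0) \<Phi>B0 f0_ereal \<and>
     continuous_on (Sigma (X0 \<times> B0) (swap_mf \<Phi>A0 \<Phi>B0)) (swap_fun f0) \<and>
     continuous_on (Sigma (Sigma X0 \<Phi>A0) \<Phi>B0) f0)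
  \<and> ((\<forall>x\<in>X0. \<forall>a\<in>\<Phi>A0 x.
        worst_loss \<Phi>B0 f0_ereal (x, a) = ereal
          (if x \<le> 0 \<or> (0 < x \<and> 0 \<le> a \<and> a < 1 / (2 * x)) then 1 + a
           else if 0 < x \<and> 1 / (2 * x) \<le> a \<and> a \<le> 1 / x then (2 * x + 1) * (1 / x - a)
           else a - 1 / x)) \<and>
     Sigma X0 \<Phi>A0 = X0 \<times> A0 \<and>
     continuous_on (Sigma X0 \<Phi>A0) (worst_loss \<Phi>B0 f0_ereal) \<and>
     \<not> K_inf_compact X0 \<Phi>A0 (worst_loss \<Phi>B0 f0_ereal))
  \<and> ((\<forall>x\<in>X0. minimax_value \<Phi>A0 \<Phi>B0 f0_ereal x = (if x \<le> 0 then 1 else 0)) \<and>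
     \<not> fun_lsc_at X0 (minimax_value \<Phi>A0 \<Phi>B0 f0_ereal) 0)
  \<and> ((\<forall>x\<in>X0. solution_mf \<Phi>A0 \<Phi>B0 f0_ereal x = (if x \<le> 0 then {0} else {1 / x})) \<and>
     \<not> mf_usc_at X0 A0 (solution_mf \<Phi>A0 \<Phi>B0 f0_ereal) 0)"
proof (intro conjI)
  show "nonempty_valued X0 A0 \<Phi>A0"
    by (auto simp: nonempty_valued_def A0_def \<Phi>A0_def)
  show "nonempty_valued (Sigma X0 \<Phi>A0) B0 \<Phi>B0"
    by (auto simp: nonempty_valued_def B0_def \<Phi>A0_def \<Phi>B0_def dest: \<phi>B0_nonneg intro: order_trans)
  show "mf_continuous X0 A0 \<Phi>A0"
    using mf_continuous_const[of X0 A0 "{0..}"] by (simp add: \<Phi>A0_def[abs_def])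
  show "mf_lsc (Sigma X0 \<Phi>A0) B0 \<Phi>B0"
    using mf_continuous_\<Phi>B0 by (simp add: mf_continuous_def)
  show "Sigma X0 \<Phi>A0 = X0 \<times> A0"
    by (auto simp: \<Phi>A0_def A0_def)
  show "\<forall>x\<in>X0. \<forall>a\<in>\<Phi>A0 x.
        worst_loss \<Phi>B0 f0_ereal (x, a) = ereal
          (if x \<le> 0 \<or> (0 < x \<and> 0 \<le> a \<and> a < 1 / (2 * x)) then 1 + a
           else if 0 < x \<and> 1 / (2 * x) \<le> a \<and> a \<le> 1 / x then (2 * x + 1) * (1 / x - a)
           else a - 1 / x)"
    by (intro ballI worst_loss_piecewise) (simp add: \<Phi>A0_def)
  show "\<forall>x\<in>X0. minimax_value \<Phi>A0 \<Phi>B0 f0_ereal x = (if x \<le> 0 then 1 else 0)"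
    by (simp add: minimax_value_nonpos minimax_value_pos)
qed (use mf_continuous_\<Phi>B0 not_A_lsc_\<Phi>B0 K_inf_compact_swap_f0 K_sup_compact_f0
      continuous_on_f0 continuous_on_swap_f0 continuous_on_worst_loss
      not_K_inf_compact_worst_loss not_fun_lsc_minimax_value solution_mf_eq
      not_mf_usc_solution in \<open>blast+\<close>)

end
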